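(* Let $G$ be a directed graph without multiedges, $s,t$ nodes of $G$, and $B$ its $s$-$t$ bridge sequence. A substring $L=(e_1,\dots,e_{k})$ of $B$ is safe under the $s$-$t$ paths model if and only if each consecutive pair of edges of $L$ is adjacent, i.e. $\mathrm{head}(e_i)=\mathrm{tail}(e_{i+1})$ for all $1\le i<k$.
   Context: An $s$-$t$ bridge is an edge whose removal leaves no $s$-$t$ path; all $s$-$t$ bridges appear on every $s$-$t$ path in the same order, and $B$ is the sequence of $s$-$t$ bridges in this order. For an edge $e=(u,v)$, $\mathrm{tail}(e)=u$, $\mathrm{head}(e)=v$. A sequence of edges is safe under the $s$-$t$ paths model if it is a substring (contiguous) of the edge sequence of every $s$-$t$ path of $G$ (a path repeats no node). *)

theory Defs
  imports "Graph_Theory.Graph_Theory" "HOL-Library.Sublist"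
begin

definition st_path :: "('a, 'b) pre_digraph \<Rightarrow> 'a \<Rightarrow> 'a \<Rightarrow> 'b list \<Rightarrow> bool" where
  "st_path G s t p \<longleftrightarrow> pre_digraph.apath G s p t"

definition st_bridge :: "('a, 'b) pre_digraph \<Rightarrow> 'a \<Rightarrow> 'a \<Rightarrow> 'b \<Rightarrow> bool" where
  "st_bridge G s t e \<longleftrightarrow>
     e \<in> arcs G \<and> \<not> (\<exists>p. st_path (pre_digraph.del_arc G e) s t p)"

text \<open>
  The list \<open>B\<close> enumerates the \<open>s\<close>-\<open>t\<close> bridges, each once, in the order in which they appear on
  every \<open>s\<close>-\<open>t\<close> path. This determines \<open>B\<close> uniquely as soon as there is an \<open>s\<close>-\<open>t\<close> path
  (lemma \<open>ex1_st_bridge_seq\<close> below). If there is none, every arc is a bridge and there is no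
  order to speak of.
\<close>

definition is_st_bridge_seq :: "('a, 'b) pre_digraph \<Rightarrow> 'a \<Rightarrow> 'a \<Rightarrow> 'b list \<Rightarrow> bool" where
  "is_st_bridge_seq G s t B \<longleftrightarrow>
     distinct B \<and> set B = {e. st_bridge G s t e} \<and> (\<forall>p. st_path G s t p \<longrightarrow> subseq B p)"

definition safe_st_paths :: "('a, 'b) pre_digraph \<Rightarrow> 'a \<Rightarrow> 'a \<Rightarrow> 'b list \<Rightarrow> bool" where
  "safe_st_paths G s t L \<longleftrightarrow> (\<forall>p. st_path G s t p \<longrightarrow> sublist L p)"

lemma st_path_distinct: "st_path G s t p \<Longrightarrow> distinct p"
  by (auto simp: st_path_def pre_digraph.apath_def pre_digraph.awalk_verts_conv distinct_map
      split: if_splits)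

lemma st_bridge_in_awalk:
  assumes "wf_digraph G" "st_bridge G s t e" "pre_digraph.awalk G s p t"
  shows "e \<in> set p"
proof (rule ccontr)
  assume "e \<notin> set p"
  interpret G: wf_digraph G by fact
  interpret H: wf_digraph "G.del_arc e" by (rule G.wf_digraph_del_arc)
  have "H.cas u q v = G.cas u q v" for u q v
    by (induction q arbitrary: u) auto
  then have "H.awalk s p t"
    using assms(3) \<open>e \<notin> set p\<close> by (auto simp: H.awalk_def G.awalk_def)
  then have "st_path (G.del_arc e) s t (H.awalk_to_apath p)"
    by (simp add: st_path_def H.apath_awalk_to_apath)
  then show False using assms(2) by (auto simp: st_bridge_def)
qed

lemma st_bridge_order:
  assumes "wf_digraph G" "st_bridge G s t e"
    and p: "st_path G s t (p1 @ e # p2)" "f \<in> set p2"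
    and q: "st_path G s t (q1 @ f # q2)" "e \<in> set q2"
  shows False
proof -
  interpret wf_digraph G by fact
  from p(2) obtain a b where ab: "p2 = a @ f # b" by (auto simp: in_set_conv_decomp)
  have "e \<notin> set b" "e \<noteq> f" using st_path_distinct[OF p(1)] ab by auto
  moreover have "e \<notin> set q1" using st_path_distinct[OF q(1)] q(2) by auto
  moreover have "awalk s (q1 @ f # b) t"
  proof -
    have "awalk s ((p1 @ e # a) @ f # b) t"
      using p(1) by (simp add: ab st_path_def apath_def)
    then have "awalk (head G f) b t"
      unfolding awalk_append_iff awalk_Cons_iff by blast
    moreover have "awalk s (q1 @ f # q2) t"
      using q(1) by (simp add: st_path_def apath_def)
    then have "awalk s q1 (awlast s q1)" "f \<in> arcs G" "awlast s q1 = tail G f"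
      unfolding awalk_append_iff awalk_Cons_iff by blast+
    ultimately show ?thesis
      unfolding awalk_append_iff awalk_Cons_iff by blast
  qed
  ultimately show False using st_bridge_in_awalk[OF assms(1,2), of "q1 @ f # b"] by simp
qed

lemma distinct_lists_eqI:
  assumes "distinct xs" "distinct ys" "set xs = set ys"
    and "\<And>a x b c y d. xs = a @ x # b \<Longrightarrow> y \<in> set b \<Longrightarrow> ys = c @ y # d \<Longrightarrow> x \<in> set d \<Longrightarrow> False"
  shows "xs = ys"
  using assms
proof (induction xs arbitrary: ys)
  case (Cons x xs)
  show ?case
  proof (cases ys)
    case (Cons y zs)
    have "x = y"
    proof (rule ccontr)
      assume "x \<noteq> y"
      then have "y \<in> set xs" "x \<in> set zs" using Cons Cons.prems(3) by auto
      then show False using Cons.prems(4)[of "[]" x xs y "[]" zs] Cons by simp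
    qed
    moreover have "xs = zs"
    proof (rule Cons.IH)
      show "set xs = set zs" using Cons.prems(1-3) \<open>x = y\<close> Cons by auto
      show False if "xs = a @ u # b" "v \<in> set b" "zs = c @ v # d" "u \<in> set d" for a u b c v d
        using Cons.prems(4)[of "x # a" u b v "y # c" d] that Cons by simp
    qed (use Cons.prems Cons in auto)
    ultimately show ?thesis using Cons by simp
  qed (use Cons.prems in simp)
qed simp

lemma filter_eq_appendD:
  assumes "filter P xs = a @ x # b"
  obtains a' b' where "xs = a' @ x # b'" "filter P b' = b" "P x"
proof -
  have "\<exists>a' b'. xs = a' @ x # b' \<and> filter P b' = b \<and> P x"
    using assms
  proof (induction xs arbitrary: a)
    case (Cons y ys)
    show ?case
    proof (cases "P y \<and> a = []")
      case True
      then show ?thesis using Cons.prems by (intro exI[of _ "[]"] exI[of _ ys]) auto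
    next
      case False
      then obtain a'' where "filter P ys = a'' @ x # b"
        using Cons.prems by (cases a) (auto split: if_splits)
      from Cons.IH[OF this] obtain a' b' where "ys = a' @ x # b'" "filter P b' = b" "P x" by blast
      then show ?thesis by (intro exI[of _ "y # a'"] exI[of _ b']) simp
    qed
  qed simp
  then show thesis using that by blast
qed

lemma subseq_distinct_eq_filter:
  "subseq B p \<Longrightarrow> distinct p \<Longrightarrow> filter (\<lambda>x. x \<in> set B) p = B"
proof (induction rule: list_emb.induct)
  case (list_emb_Cons xs ys y)
  then have "y \<notin> set xs" by (auto dest: list_emb_set)
  then show ?case using list_emb_Cons by simp
next
  case (list_emb_Cons2 x y xs ys)
  then have "filter (\<lambda>z. z \<in> set (x # xs)) ys = filter (\<lambda>z. z \<in> set xs) ys"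
    by (intro filter_cong) auto
  then show ?case using list_emb_Cons2 by simp
qed simp

lemma ex1_st_bridge_seq:
  assumes "wf_digraph G" "st_path G s t p"
  shows "\<exists>!B. is_st_bridge_seq G s t B"
proof (rule ex_ex1I)
  let ?P = "st_bridge G s t"
  have mem: "e \<in> set q" if "?P e" "st_path G s t q" for e q
    using st_bridge_in_awalk[OF assms(1) that(1)] that(2)
    by (simp add: st_path_def pre_digraph.apath_def)
  have eq: "filter ?P p = filter ?P q" if q: "st_path G s t q" for q
  proof (rule distinct_lists_eqI)
    show "distinct (filter ?P p)" "distinct (filter ?P q)"
      using assms(2) q by (auto dest: st_path_distinct)
    show "set (filter ?P p) = set (filter ?P q)" using mem assms(2) q by auto
    fix a x b c y d
    assume 1: "filter ?P p = a @ x # b" "y \<in> set b" and 2: "filter ?P q = c @ y # d" "x \<in> set d"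
    from 1(1) obtain a' b' where p: "p = a' @ x # b'" "filter ?P b' = b" "?P x"
      by (rule filter_eq_appendD)
    from 2(1) obtain c' d' where q': "q = c' @ y # d'" "filter ?P d' = d"
      by (rule filter_eq_appendD)
    show False
      using st_bridge_order[OF assms(1) p(3), of a' b' y c' d'] assms(2) q p q' 1(2) 2(2) by auto
  qed
  have "is_st_bridge_seq G s t (filter ?P p)"
    unfolding is_st_bridge_seq_def
  proof (intro conjI allI impI)
    show "distinct (filter ?P p)" using assms(2) by (simp add: st_path_distinct)
    show "set (filter ?P p) = {e. ?P e}" using mem assms(2) by auto
    show "subseq (filter ?P p) q" if "st_path G s t q" for q
      unfolding eq[OF that] by (rule subseq_filter_left)
  qed
  then show "\<exists>B. is_st_bridge_seq G s t B" ..
  have det: "B = filter ?P p" if "is_st_bridge_seq G s t B" for B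
  proof -
    have "filter (\<lambda>x. x \<in> set B) p = B"
      using that assms(2)
      by (intro subseq_distinct_eq_filter) (auto simp: is_st_bridge_seq_def st_path_distinct)
    moreover have "(x \<in> set B) = ?P x" for x using that by (simp add: is_st_bridge_seq_def)
    ultimately show ?thesis by simp
  qed
  show "B = B'" if "is_st_bridge_seq G s t B" "is_st_bridge_seq G s t B'" for B B'
    using det[OF that(1)] det[OF that(2)] by simp
qed

end

theory Submission
  imports Defs
begin

text \<open>
  Adjacency is necessary because any two consecutive arcs of a path are adjacent. Conversely, \<open>L\<close>
  is a subsequence of every \<open>s\<close>-\<open>t\<close> path \<open>p\<close>, since \<open>B\<close> is. If \<open>p\<close> made a detour between two
  consecutive arcs of \<open>L\<close>, it would visit their common node twice; hence \<open>L\<close> occurs contiguously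
  in \<open>p\<close>.
\<close>

context wf_digraph
begin

lemma awalk_successively_adjacent:
  "awalk u p v \<Longrightarrow> successively (\<lambda>e f. head G e = tail G f) p"
proof (induction p arbitrary: u)
  case (Cons e p)
  then show ?case by (cases p) (auto simp: awalk_Cons_iff)
qed simp

lemma tail_in_awalk_verts:
  assumes "awalk u p v" "e \<in> set p"
  shows "tail G e \<in> set (awalk_verts u p)"
  using assms by (auto simp: awalk_verts_conv)

lemma apath_adjacent_subseq_prefix:
  assumes "apath u p v" "subseq L p" "successively (\<lambda>e f. head G e = tail G f) L"
    and "L \<noteq> [] \<Longrightarrow> tail G (hd L) = u"
  shows "prefix L p"
  using assms
proof (induction p arbitrary: u L)
  case (Cons e p)
  show ?case
  proof (cases L)
    case L: (Cons f L')
    from Cons.prems(1) have p: "apath (head G e) p v" and u: "u \<notin> set (awalk_verts (head G e) p)"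
      by (auto simp: apath_Cons_iff)
    have "f = e"
    proof (rule ccontr)
      assume "f \<noteq> e"
      then have "f \<in> set p"
        using Cons.prems(2) L by (auto dest: list_emb_set)
      with p have "tail G f \<in> set (awalk_verts (head G e) p)"
        by (intro tail_in_awalk_verts) (auto simp: apath_def)
      then show False using Cons.prems(4) L u by simp
    qed
    moreover have "prefix L' p"
    proof (rule Cons.IH[OF p])
      show "subseq L' p" using Cons.prems(2) L \<open>f = e\<close> by simp
      show "successively (\<lambda>e f. head G e = tail G f) L'" "L' \<noteq> [] \<Longrightarrow> tail G (hd L') = head G e"
        using Cons.prems(3) L \<open>f = e\<close> by (auto simp: successively_Cons)
    qed
    ultimately show ?thesis using L by simp
  qed simp
qed simp

lemma apath_adjacent_subseq_sublist:
  assumes "apath u p v" "subseq L p" "successively (\<lambda>e f. head G e = tail G f) L"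
  shows "sublist L p"
  using assms
proof (induction p arbitrary: u)
  case (Cons e p)
  show ?case
  proof (cases "subseq L p")
    case True
    with Cons have "sublist L p" by (auto simp: apath_Cons_iff)
    then show ?thesis by (simp add: sublist_Cons_right)
  next
    case False
    then have "L \<noteq> []" "hd L = e"
      using Cons.prems(2) by (auto elim: list_emb.cases)
    then have "prefix L (e # p)"
      using Cons.prems by (intro apath_adjacent_subseq_prefix) (auto simp: apath_Cons_iff)
    then show ?thesis by (rule prefix_imp_sublist)
  qed
qed simp

end

theorem theorem6:
  fixes G :: "('a, 'b) pre_digraph" and s t :: 'a and B L :: "'b list"
  assumes "nomulti_digraph G"
    and "s \<in> verts G" and "t \<in> verts G"
    and "\<exists>p. st_path G s t p"
    and "is_st_bridge_seq G s t B"
    and "sublist L B"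
  shows "safe_st_paths G s t L \<longleftrightarrow>
    (\<forall>i. Suc i < length L \<longrightarrow> head G (L ! i) = tail G (L ! Suc i))"
proof -
  interpret nomulti_digraph G by fact
  have "safe_st_paths G s t L \<longleftrightarrow> successively (\<lambda>e f. head G e = tail G f) L"
  proof
    assume "safe_st_paths G s t L"
    with assms(4) obtain p where "awalk s p t" "sublist L p"
      by (auto simp: safe_st_paths_def st_path_def apath_def)
    then show "successively (\<lambda>e f. head G e = tail G f) L"
      using awalk_successively_adjacent[of s p t]
      by (auto simp: sublist_def successively_append_iff)
  next
    assume adj: "successively (\<lambda>e f. head G e = tail G f) L"
    show "safe_st_paths G s t L"
      unfolding safe_st_paths_def
    proof (intro allI impI)
      fix p assume p: "st_path G s t p"
      then have "subseq B p" using assms(5) by (simp add: is_st_bridge_seq_def)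
      with assms(6) have "subseq L p"
        using sublist_imp_subseq subseq_order.trans by blast
      with p adj show "sublist L p"
        by (auto simp: st_path_def intro: apath_adjacent_subseq_sublist)
    qed
  qed
  then show ?thesis by (simp add: successively_conv_nth)
qed

end
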